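(* Let $(p_{ij} \colon X_j \to X_i)_{i \sqsubseteq j \in I}$ be a projective system of topological spaces, with canonical projective limit $X, (p_i)_{i \in I}$. If every $p_{ij}$ is proper and if every $X_i$ is $\odot$-consonant and sober, then $X$ is $\odot$-consonant and sober.
   Context: $\mathcal O X$ is the lattice of open subsets of $X$. The specialization preordering is: $x \leq y$ iff every open neighborhood of $x$ contains $y$; $\downarrow A$ denotes downward closure. A subset is saturated iff it is upwards-closed. Compactness is the open cover property, with no separation axiom. A space is sober iff it is $T_0$ and every irreducible closed subset is the closure of a point. A continuous map $f \colon X \to Y$ is proper iff $\downarrow f[F]$ is closed for every closed $F \subseteq X$ and $f^{-1}(Q)$ is compact saturated for every compact saturated $Q \subseteq Y$. A space $X$ is consonant iff for every Scott-open subset $\mathcal U$ of $\mathcal O X$ (ordered by inclusion) and every $U \in \mathcal U$, there is a compact saturated subset $Q$ of $X$ such that $Q \subseteq U$ and every open neighborhood of $Q$ belongs to $\mathcal U$. $X$ is $\odot$-consonant iff for every $n \in \mathbb N$ the copower $n \odot X$, the topological sum of $n$ copies of $X$, is consonant. A projective system $(p_{ij} \colon X_j \to X_i)_{i \sqsubseteq j \in I}$ consists of a directed preordered set $(I,\sqsubseteq)$, spaces $X_i$, and continuous maps $p_{ij}$ ($i \sqsubseteq j$) with $p_{ii} = \mathrm{id}$ and $p_{ij} \circ p_{jk} = p_{ik}$ for $i \sqsubseteq j \sqsubseteq k$. Its canonical projective limit is $X = \{\vec x \in \prod_{i} X_i \mid p_{ij}(x_j) = x_i \text{ for all } i \sqsubseteq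 j\}$ with the subspace topology of the product, $p_i$ being projection onto coordinate $i$. *)

theory Defs
  imports "HOL-Analysis.Analysis"
begin

text \<open>Specialization preordering. Note the orientation: \<open>x \<le> y\<close> means that every open
  neighborhood of \<open>x\<close> contains \<open>y\<close>.\<close>

definition spec_le :: "'a topology \<Rightarrow> 'a \<Rightarrow> 'a \<Rightarrow> bool" where
  "spec_le X x y \<longleftrightarrow> x \<in> topspace X \<and> y \<in> topspace X \<and>
     (\<forall>U. openin X U \<and> x \<in> U \<longrightarrow> y \<in> U)"

definition down_closure :: "'a topology \<Rightarrow> 'a set \<Rightarrow> 'a set" where
  "down_closure X A = {x. \<exists>a\<in>A. spec_le X x a}"

definition saturated_in :: "'a topology \<Rightarrow> 'a set \<Rightarrow> bool" where
  "saturated_in X A \<longleftrightarrow> A \<subseteq> topspace X \<and> (\<forall>x y. x \<in> A \<and> spec_le X x y \<longrightarrow> y \<in> A)"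

definition compact_saturated_in :: "'a topology \<Rightarrow> 'a set \<Rightarrow> bool" where
  "compact_saturated_in X Q \<longleftrightarrow> compactin X Q \<and> saturated_in X Q"

definition irreducible_closed_in :: "'a topology \<Rightarrow> 'a set \<Rightarrow> bool" where
  "irreducible_closed_in X C \<longleftrightarrow> closedin X C \<and> C \<noteq> {} \<and>
     (\<forall>A B. closedin X A \<and> closedin X B \<and> C \<subseteq> A \<union> B \<longrightarrow> C \<subseteq> A \<or> C \<subseteq> B)"

definition sober_space :: "'a topology \<Rightarrow> bool" where
  "sober_space X \<longleftrightarrow> t0_space X \<and>
     (\<forall>C. irreducible_closed_in X C \<longrightarrow> (\<exists>x\<in>topspace X. C = X closure_of {x}))"

text \<open>Proper continuous maps in the sense of non-Hausdorff topology. This is not the library's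
  \<^const>\<open>proper_map\<close>, which is closed with compact fibers and neither involves the
  specialization preordering nor assumes continuity.\<close>

definition proper_continuous_map :: "'a topology \<Rightarrow> 'b topology \<Rightarrow> ('a \<Rightarrow> 'b) \<Rightarrow> bool" where
  "proper_continuous_map X Y f \<longleftrightarrow> continuous_map X Y f \<and>
     (\<forall>F. closedin X F \<longrightarrow> closedin Y (down_closure Y (f ` F))) \<and>
     (\<forall>Q. compact_saturated_in Y Q \<longrightarrow> compact_saturated_in X {x \<in> topspace X. f x \<in> Q})"

text \<open>Directed sets are nonempty by convention.\<close>

definition directed_under :: "('a \<Rightarrow> 'a \<Rightarrow> bool) \<Rightarrow> 'a set \<Rightarrow> bool" where
  "directed_under le D \<longleftrightarrow> D \<noteq> {} \<and> (\<forall>x\<in>D. \<forall>y\<in>D. \<exists>z\<in>D. le x z \<and> le y z)"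

text \<open>Scott-open subsets of the lattice of open subsets of \<open>X\<close>, where suprema are unions.\<close>

definition scott_open_opens :: "'a topology \<Rightarrow> 'a set set \<Rightarrow> bool" where
  "scott_open_opens X \<U> \<longleftrightarrow> \<U> \<subseteq> {U. openin X U} \<and>
     (\<forall>U V. U \<in> \<U> \<and> openin X V \<and> U \<subseteq> V \<longrightarrow> V \<in> \<U>) \<and>
     (\<forall>\<D>. \<D> \<subseteq> {U. openin X U} \<and> directed_under (\<subseteq>) \<D> \<and> \<Union>\<D> \<in> \<U> \<longrightarrow> \<D> \<inter> \<U> \<noteq> {})"

definition consonant_space :: "'a topology \<Rightarrow> bool" where
  "consonant_space X \<longleftrightarrow>
     (\<forall>\<U> U. scott_open_opens X \<U> \<and> U \<in> \<U> \<longrightarrow>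
        (\<exists>Q. compact_saturated_in X Q \<and> Q \<subseteq> U \<and> (\<forall>V. openin X V \<and> Q \<subseteq> V \<longrightarrow> V \<in> \<U>)))"

definition copower :: "nat \<Rightarrow> 'a topology \<Rightarrow> (nat \<times> 'a) topology" where
  "copower n X = sum_topology (\<lambda>_. X) {..<n}"

definition odot_consonant_space :: "'a topology \<Rightarrow> bool" where
  "odot_consonant_space X \<longleftrightarrow> (\<forall>n. consonant_space (copower n X))"

text \<open>The map \<open>p i j\<close> goes from \<open>X j\<close> to \<open>X i\<close> whenever \<open>i \<sqsubseteq> j\<close>; its values elsewhere are
  irrelevant.\<close>

definition projective_system ::
  "'i set \<Rightarrow> ('i \<Rightarrow> 'i \<Rightarrow> bool) \<Rightarrow> ('i \<Rightarrow> 'a topology) \<Rightarrow> ('i \<Rightarrow> 'i \<Rightarrow> 'a \<Rightarrow> 'a) \<Rightarrow> bool" where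
  "projective_system I le X p \<longleftrightarrow>
     reflp_on I le \<and> transp_on I le \<and> directed_under le I \<and>
     (\<forall>i\<in>I. \<forall>j\<in>I. le i j \<longrightarrow> continuous_map (X j) (X i) (p i j)) \<and>
     (\<forall>i\<in>I. \<forall>x\<in>topspace (X i). p i i x = x) \<and>
     (\<forall>i\<in>I. \<forall>j\<in>I. \<forall>k\<in>I. le i j \<and> le j k \<longrightarrow>
        (\<forall>x\<in>topspace (X k). p i j (p j k x) = p i k x))"

definition projective_limit ::
  "'i set \<Rightarrow> ('i \<Rightarrow> 'i \<Rightarrow> bool) \<Rightarrow> ('i \<Rightarrow> 'a topology) \<Rightarrow> ('i \<Rightarrow> 'i \<Rightarrow> 'a \<Rightarrow> 'a) \<Rightarrow> ('i \<Rightarrow> 'a) topology" where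
  "projective_limit I le X p = subtopology (product_topology X I)
     {x \<in> topspace (product_topology X I). \<forall>i\<in>I. \<forall>j\<in>I. le i j \<longrightarrow> p i j (x j) = x i}"

end

theory Submission
  imports Defs
begin

text \<open>Consonance of the limit rests on the fact that the projections \<open>x \<mapsto> x i\<close> of the limit \<open>L\<close> are again proper
  (\<open>proper_projection\<close>). This is an existence statement in the manner of Steenrod's theorem on
  limits of compact sober spaces: given closed sets \<open>F j\<close> compatible with the maps \<open>p j k\<close>, each
  meeting a compact saturated set \<open>Q j\<close>, there is a thread \<open>z\<close> with \<open>z j \<in> F j \<inter> Q j\<close>. One shrinks
  the \<open>F j\<close> to a minimal such system by Zorn's lemma; its members are irreducible, so sobriety
  provides generic points, and these form the thread (\<open>thread_in_compact_saturated\<close>).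

  Consonance is then transported as follows. Let \<open>\<U>\<close> be a Scott-open family of open subsets of \<open>L\<close>
  and \<open>U \<in> \<U>\<close>. The preimages of open subsets of the \<open>X i\<close> form a base of \<open>L\<close>, and those inside \<open>U\<close>
  form a directed family with union \<open>U\<close>, so one of them, coming from \<open>V \<subseteq> X i\<close> say, is in \<open>\<U>\<close>. The
  open subsets of \<open>X i\<close> with preimage in \<open>\<U>\<close> form a Scott-open family, so consonance of \<open>X i\<close> yields a
  compact saturated set \<open>Q \<subseteq> V\<close> all of whose open neighborhoods belong to that family. Since the
  projection is proper, the preimage of \<open>Q\<close> is compact saturated, and each of its open neighborhoods
  contains the preimage of an open neighborhood of \<open>Q\<close>, hence is in \<open>\<U>\<close>. The argument uses of
  the limit only a family of proper maps with this base property
  (\<open>consonant_space_if_proper_family\<close>). The maps \<open>n \<odot> L \<rightarrow> n \<odot> X i\<close> induced by the projections are such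
  a family too, and so every copower of \<open>L\<close> is consonant.

  Sobriety of \<open>L\<close> is seen coordinatewise: the closures of the images of an irreducible closed set
  \<open>C\<close> in the \<open>X i\<close> are irreducible, and their generic points form a thread, which is the generic
  point of \<open>C\<close>.\<close>

section \<open>Closures and the specialization preordering\<close>

lemma closure_of_image_closure_of:
  assumes f: "continuous_map X Y f" and A: "A \<subseteq> topspace X"
  shows "Y closure_of (f ` (X closure_of A)) = Y closure_of (f ` A)"
proof (rule antisym)
  show "Y closure_of (f ` (X closure_of A)) \<subseteq> Y closure_of (f ` A)"
    by (intro closure_of_minimal continuous_map_image_closure_subset[OF f] closedin_closure_of)
  show "Y closure_of (f ` A) \<subseteq> Y closure_of (f ` (X closure_of A))"
    by (intro closure_of_mono image_mono closure_of_subset A)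
qed

lemma spec_le_closure_of:
  "spec_le X x y \<longleftrightarrow> y \<in> topspace X \<and> x \<in> X closure_of {y}"
  by (auto simp: spec_le_def in_closure_of)

lemma spec_le_refl: "x \<in> topspace X \<Longrightarrow> spec_le X x x"
  by (simp add: spec_le_def)

lemma spec_le_trans: "spec_le X x y \<Longrightarrow> spec_le X y z \<Longrightarrow> spec_le X x z"
  by (auto simp: spec_le_def)

lemma spec_le_continuous_map:
  assumes "continuous_map X Y f" "spec_le X x y"
  shows "spec_le Y (f x) (f y)"
proof -
  have "f y \<in> U" if "openin Y U" "f x \<in> U" for U
    using assms openin_continuous_map_preimage[OF assms(1) that(1)] that(2)
    by (auto simp: spec_le_def)
  moreover have "f x \<in> topspace Y" "f y \<in> topspace Y"
    using assms continuous_map_image_subset_topspace[of X Y f] by (auto simp: spec_le_def)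
  ultimately show ?thesis
    by (simp add: spec_le_def)
qed

lemma saturated_in_preimage:
  assumes "continuous_map X Y f" "saturated_in Y Q"
  shows "saturated_in X {x \<in> topspace X. f x \<in> Q}"
  unfolding saturated_in_def
proof (intro conjI allI impI)
  fix x y assume "x \<in> {x \<in> topspace X. f x \<in> Q} \<and> spec_le X x y"
  then have "f x \<in> Q" "spec_le Y (f x) (f y)" "y \<in> topspace X"
    using spec_le_continuous_map[OF assms(1)] by (auto simp: spec_le_def)
  then show "y \<in> {x \<in> topspace X. f x \<in> Q}"
    using assms(2) unfolding saturated_in_def by blast
qed blast

text \<open>Every open neighborhood of \<open>x\<close> contains the whole of \<open>\<up>x\<close>, so a single member of an open
  cover already covers it.\<close>

lemma compact_saturated_in_up:
  assumes "x \<in> topspace X"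
  shows "compact_saturated_in X {y. spec_le X x y}"
  unfolding compact_saturated_in_def
proof
  show "compactin X {y. spec_le X x y}"
    unfolding compactin_def
  proof (intro conjI allI impI)
    show "{y. spec_le X x y} \<subseteq> topspace X" by (auto simp: spec_le_def)
    fix \<U> assume U: "Ball \<U> (openin X) \<and> {y. spec_le X x y} \<subseteq> \<Union>\<U>"
    then obtain U where "U \<in> \<U>" "x \<in> U"
      using spec_le_refl[OF assms] by blast
    with U have "{y. spec_le X x y} \<subseteq> U" by (auto simp: spec_le_def)
    with \<open>U \<in> \<U>\<close> show "\<exists>\<F>. finite \<F> \<and> \<F> \<subseteq> \<U> \<and> {y. spec_le X x y} \<subseteq> \<Union>\<F>"
      by (intro exI[of _ "{U}"]) auto
  qed
  show "saturated_in X {y. spec_le X x y}"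
    using spec_le_trans by (auto simp: saturated_in_def) (auto simp: spec_le_def)
qed

lemma compactin_Inter_directed:
  assumes Q: "compactin X Q" and ne: "K \<noteq> {}"
    and cl: "\<And>k. k \<in> K \<Longrightarrow> closedin X (F k)"
    and dir: "\<And>k l. k \<in> K \<Longrightarrow> l \<in> K \<Longrightarrow> \<exists>m\<in>K. F m \<subseteq> F k \<inter> F l"
    and meets: "\<And>k. k \<in> K \<Longrightarrow> F k \<inter> Q \<noteq> {}"
  shows "(\<Inter>k\<in>K. F k) \<inter> Q \<noteq> {}"
proof -
  have below: "\<exists>k\<in>K. F k \<subseteq> \<Inter>\<F>" if "finite \<F>" "\<F> \<subseteq> F ` K" for \<F>
    using that
  proof (induction \<F> rule: finite_induct)
    case empty
    then show ?case using ne by auto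
  next
    case (insert A \<F>)
    then obtain k l where "k \<in> K" "F k \<subseteq> \<Inter>\<F>" "l \<in> K" "A = F l" by auto
    then show ?case using dir[of k l] by (auto; blast)
  qed
  have "Q \<inter> \<Inter>(F ` K) \<noteq> {}"
  proof -
    have "Q \<inter> \<Inter>\<F> \<noteq> {}" if "finite \<F>" "\<F> \<subseteq> F ` K" for \<F>
      using below[OF that] meets by blast
    then show ?thesis
      using Q cl unfolding compactin_fip by (metis (no_types, lifting) imageE)
  qed
  then show ?thesis by (simp add: Int_commute)
qed

section \<open>Threads through compatible closed sets\<close>

locale proj_system =
  fixes I :: "'i set"
    and le :: "'i \<Rightarrow> 'i \<Rightarrow> bool"
    and X :: "'i \<Rightarrow> 'a topology"
    and p :: "'i \<Rightarrow> 'i \<Rightarrow> 'a \<Rightarrow> 'a"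
  assumes sys: "projective_system I le X p"
begin

abbreviation L :: "('i \<Rightarrow> 'a) topology" where
  "L \<equiv> projective_limit I le X p"

lemma le_refl: "i \<in> I \<Longrightarrow> le i i"
  using sys by (auto simp: projective_system_def reflp_on_def)

lemma le_trans: "le i j \<Longrightarrow> le j k \<Longrightarrow> i \<in> I \<Longrightarrow> j \<in> I \<Longrightarrow> k \<in> I \<Longrightarrow> le i k"
  using sys unfolding projective_system_def transp_on_def by blast

lemma upper_bound:
  assumes "i \<in> I" "j \<in> I"
  obtains k where "k \<in> I" "le i k" "le j k"
  using sys assms unfolding projective_system_def directed_under_def by blast

lemma finite_upper_bound:
  assumes "finite K" "K \<subseteq> I"
  shows "\<exists>k\<in>I. \<forall>i\<in>K. le i k"
  using assms
proof (induction K rule: finite_induct)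
  case empty
  then show ?case using sys by (auto simp: projective_system_def directed_under_def)
next
  case (insert i K)
  then obtain k where k: "k \<in> I" "\<forall>i\<in>K. le i k" by auto
  with insert.prems obtain m where "m \<in> I" "le i m" "le k m"
    using upper_bound by (metis insert_subset)
  then show ?case using k insert.prems by (auto intro: le_trans)
qed

lemma p_cont: "i \<in> I \<Longrightarrow> j \<in> I \<Longrightarrow> le i j \<Longrightarrow> continuous_map (X j) (X i) (p i j)"
  using sys by (auto simp: projective_system_def)

lemma p_topspace:
  "i \<in> I \<Longrightarrow> j \<in> I \<Longrightarrow> le i j \<Longrightarrow> x \<in> topspace (X j) \<Longrightarrow> p i j x \<in> topspace (X i)"
  using continuous_map_image_subset_topspace[OF p_cont[of i j]] by blast

lemma p_id: "i \<in> I \<Longrightarrow> x \<in> topspace (X i) \<Longrightarrow> p i i x = x"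
  using sys by (auto simp: projective_system_def)

lemma p_comp:
  "i \<in> I \<Longrightarrow> j \<in> I \<Longrightarrow> k \<in> I \<Longrightarrow> le i j \<Longrightarrow> le j k \<Longrightarrow> x \<in> topspace (X k)
    \<Longrightarrow> p i j (p j k x) = p i k x"
  using sys unfolding projective_system_def by blast

lemma topspace_L:
  "topspace L = {x \<in> (\<Pi>\<^sub>E i\<in>I. topspace (X i)). \<forall>i\<in>I. \<forall>j\<in>I. le i j \<longrightarrow> p i j (x j) = x i}"
  unfolding projective_limit_def by (auto simp: topspace_subtopology)

lemma L_component: "x \<in> topspace L \<Longrightarrow> i \<in> I \<Longrightarrow> x i \<in> topspace (X i)"
  by (auto simp: topspace_L)

lemma L_thread: "x \<in> topspace L \<Longrightarrow> i \<in> I \<Longrightarrow> j \<in> I \<Longrightarrow> le i j \<Longrightarrow> p i j (x j) = x i"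
  by (auto simp: topspace_L)

lemma proj_cont: "i \<in> I \<Longrightarrow> continuous_map L (X i) (\<lambda>x. x i)"
  unfolding projective_limit_def
  by (intro continuous_map_from_subtopology continuous_map_product_projection)

text \<open>A thread of closures of points is a thread of points, since points of a \<open>T\<^sub>0\<close> space are
  determined by their closures.\<close>

lemma generic_points_thread:
  assumes t0: "\<And>i. i \<in> I \<Longrightarrow> t0_space (X i)"
    and z: "\<And>i. i \<in> I \<Longrightarrow> z i \<in> topspace (X i)"
    and F: "\<And>i. i \<in> I \<Longrightarrow> F i = X i closure_of {z i}"
    and thread: "\<And>i j. i \<in> I \<Longrightarrow> j \<in> I \<Longrightarrow> le i j \<Longrightarrow> X i closure_of (p i j ` F j) = F i"
  shows "restrict z I \<in> topspace L"
proof -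
  have "p i j (z j) = z i" if ij: "i \<in> I" "j \<in> I" "le i j" for i j
  proof -
    have "X i closure_of {p i j (z j)} = X i closure_of (p i j ` F j)"
      using closure_of_image_closure_of[OF p_cont[OF ij], of "{z j}"] F z ij by simp
    also have "\<dots> = X i closure_of {z i}" using thread F ij by simp
    finally show ?thesis
      using t0 p_topspace z ij by (simp add: t0_space_closure_of_sing)
  qed
  then show ?thesis using z by (auto simp: topspace_L)
qed

text \<open>Among all compatible systems of closed sets inside the \<open>F i\<close> that meet every \<open>Q j\<close>, a minimal
  system \<open>M\<close> exists by Zorn's lemma, because the \<open>Q j\<close> are compact. If \<open>M i\<close> is covered by two closed
  sets, then cutting down every \<open>M j\<close> above it to the preimage of one of them, suitably chosen, still
  leaves something in each \<open>Q j\<close>; so minimality makes \<open>M i\<close> irreducible. Minimality also makes the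
  image of \<open>M j\<close> in \<open>M i\<close> dense. Hence the generic points of the \<open>M i\<close> form a thread. It runs through
  the sets \<open>Q j\<close>, since the generic point of \<open>M j\<close> is above every point of \<open>M j\<close>, in particular above
  one in \<open>Q j\<close>, and \<open>Q j\<close> is saturated.\<close>

lemma thread_in_compact_saturated:
  assumes sober: "\<And>i. i \<in> I \<Longrightarrow> sober_space (X i)"
    and J: "J \<subseteq> I" and cofinal: "\<And>i. i \<in> I \<Longrightarrow> \<exists>j\<in>J. le i j"
    and Q: "\<And>j. j \<in> J \<Longrightarrow> compact_saturated_in (X j) (Q j)"
    and pQ: "\<And>j k. j \<in> J \<Longrightarrow> k \<in> J \<Longrightarrow> le j k \<Longrightarrow> p j k ` Q k \<subseteq> Q j"
    and F_closed: "\<And>i. i \<in> I \<Longrightarrow> closedin (X i) (F i)"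
    and pF: "\<And>i j. i \<in> I \<Longrightarrow> j \<in> I \<Longrightarrow> le i j \<Longrightarrow> p i j ` F j \<subseteq> F i"
    and F_meets: "\<And>j. j \<in> J \<Longrightarrow> F j \<inter> Q j \<noteq> {}"
  obtains z where "z \<in> topspace L" "\<And>i. i \<in> I \<Longrightarrow> z i \<in> F i" "\<And>j. j \<in> J \<Longrightarrow> z j \<in> Q j"
proof -
  define good where "good G \<longleftrightarrow>
      (\<forall>i\<in>I. closedin (X i) (G i)) \<and>
      (\<forall>i\<in>I. \<forall>j\<in>I. le i j \<longrightarrow> p i j ` G j \<subseteq> G i) \<and>
      (\<forall>j\<in>J. G j \<inter> Q j \<noteq> {})" for G :: "'i \<Rightarrow> 'a set"
  have J_upper: "\<exists>k\<in>J. le i k \<and> le j k" if ij: "i \<in> I" "j \<in> I" for i j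
  proof -
    obtain m where m: "m \<in> I" "le i m" "le j m" using upper_bound[OF ij] by blast
    then obtain k where k: "k \<in> J" "le m k" using cofinal by blast
    then have "k \<in> I" using J by blast
    then have "le i k" "le j k" using m k ij le_trans by blast+
    then show ?thesis using k by blast
  qed
  let ?A = "{G. good G \<and> G \<le> F}"
  have "good F" using F_closed pF F_meets by (auto simp: good_def)
  have "\<exists>M\<in>?A. \<forall>G\<in>?A. M \<ge> G \<longrightarrow> G = M"
  proof (rule predicate_Zorn)
    show "partial_order_on ?A (relation_of (\<ge>) ?A)"
      by (rule partial_order_on_relation_ofI) auto
    fix C assume C: "C \<in> Chains (relation_of (\<ge>) ?A)"
    then have CA: "G \<in> ?A" if "G \<in> C" for G
      using that by (auto simp: Chains_def relation_of_def)
    have chain: "G \<le> H \<or> H \<le> G" if "G \<in> C" "H \<in> C" for G H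
      using C that by (auto simp: Chains_def relation_of_def)
    show "\<exists>U\<in>?A. \<forall>G\<in>C. G \<ge> U"
    proof (cases "C = {}")
      case True
      then show ?thesis using \<open>good F\<close> by auto
    next
      case False
      let ?U = "\<lambda>i. \<Inter>G\<in>C. G i"
      have "good ?U" unfolding good_def
      proof (intro conjI ballI impI)
        fix i assume "i \<in> I"
        then show "closedin (X i) (?U i)"
          using CA False by (intro closedin_INT) (auto simp: good_def)
      next
        fix i j assume "i \<in> I" "j \<in> I" "le i j"
        then show "p i j ` ?U j \<subseteq> ?U i"
          using CA unfolding good_def by blast
      next
        fix j assume j: "j \<in> J"
        show "?U j \<inter> Q j \<noteq> {}"
        proof (rule compactin_Inter_directed)
          show "compactin (X j) (Q j)" using Q j by (simp add: compact_saturated_in_def)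
          show "closedin (X j) (G j)" "G j \<inter> Q j \<noteq> {}" if "G \<in> C" for G
            using CA[OF that] j J by (auto simp: good_def)
          show "\<exists>K\<in>C. K j \<subseteq> G j \<inter> H j" if "G \<in> C" "H \<in> C" for G H
            using chain[OF that] that by (auto simp: le_fun_def)
        qed (fact False)
      qed
      moreover have "?U \<le> F" using CA False by (fastforce simp: le_fun_def)
      ultimately show ?thesis by (intro bexI[of _ ?U]) (auto simp: le_fun_def)
    qed
  qed
  then obtain M where "good M" "M \<le> F" and "\<And>G. good G \<Longrightarrow> G \<le> F \<Longrightarrow> G \<le> M \<Longrightarrow> G = M"
    by blast
  then have minimal: "G = M" if "good G" "G \<le> M" for G
    using that by (meson order_trans)
  have M_closed: "closedin (X i) (M i)" if "i \<in> I" for i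
    using \<open>good M\<close> that by (auto simp: good_def)
  then have M_sub: "M i \<subseteq> topspace (X i)" if "i \<in> I" for i
    using that closedin_subset by blast
  have pM: "p i j x \<in> M i" if "i \<in> I" "j \<in> I" "le i j" "x \<in> M j" for i j x
    using \<open>good M\<close> that unfolding good_def by blast
  have M_meets: "M j \<inter> Q j \<noteq> {}" if "j \<in> J" for j
    using \<open>good M\<close> that by (auto simp: good_def)

  have irred: "irreducible_closed_in (X i) (M i)" if i: "i \<in> I" for i
    unfolding irreducible_closed_in_def
  proof (intro conjI allI impI)
    show "closedin (X i) (M i)" by (rule M_closed[OF i])
    obtain k where "k \<in> J" "le i k" using cofinal[OF i] by blast
    then show "M i \<noteq> {}" using M_meets[of k] pM[of i k] i J by blast
    fix A B assume AB: "closedin (X i) A \<and> closedin (X i) B \<and> M i \<subseteq> A \<union> B"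
    define cut where "cut D j = (if j \<in> I \<and> le i j then {x \<in> M j. p i j x \<in> D} else M j)" for D j
    have sub: "M i \<subseteq> D" if "closedin (X i) D" "\<forall>j\<in>J. cut D j \<inter> Q j \<noteq> {}" for D
    proof -
      have "good (cut D)" unfolding good_def
      proof (intro conjI ballI impI)
        fix j assume "j \<in> I"
        then show "closedin (X j) (cut D j)"
          using M_closed[of j] closedin_continuous_map_preimage_gen[OF p_cont[of i j] M_closed[of j] that(1)] i
          by (simp add: cut_def)
      next
        fix j k assume jk: "j \<in> I" "k \<in> I" "le j k"
        show "p j k ` cut D k \<subseteq> cut D j"
        proof (cases "le i j")
          case True
          then have ik: "le i k" using le_trans jk i by blast
          show ?thesis
          proof
            fix y assume "y \<in> p j k ` cut D k"
            then obtain x where x: "x \<in> M k" "p i k x \<in> D" "y = p j k x"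
              using jk ik by (auto simp: cut_def)
            then show "y \<in> cut D j"
              using True jk pM[OF jk] p_comp[OF i jk(1,2) True jk(3)] M_sub[OF jk(2)]
              by (auto simp: cut_def)
          qed
        next
          case False
          then show ?thesis using jk pM[OF jk] by (auto simp: cut_def split: if_splits)
        qed
      qed (use that(2) in blast)
      then have "cut D = M" by (rule minimal) (auto simp: cut_def le_fun_def)
      then have "cut D i = M i" by simp
      then have "p i i x \<in> D" if "x \<in> M i" for x
        using that i le_refl[OF i] unfolding cut_def by auto
      then show ?thesis using p_id[OF i] M_sub[OF i] by (metis subsetD subsetI)
    qed
    show "M i \<subseteq> A \<or> M i \<subseteq> B"
    proof (rule ccontr)
      assume "\<not> (M i \<subseteq> A \<or> M i \<subseteq> B)"
      then obtain k l where kl: "k \<in> J" "cut A k \<inter> Q k = {}" "l \<in> J" "cut B l \<inter> Q l = {}"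
        using sub AB by metis
      \<comment> \<open>If the cut by \<open>A\<close> misses \<open>Q k\<close> and the cut by \<open>B\<close> misses \<open>Q l\<close>, then above both \<open>k\<close> and \<open>l\<close>
        a point of \<open>M m \<inter> Q m\<close> has nowhere to go in \<open>M i\<close>.\<close>
      obtain m where m: "m \<in> J" "le k m" "le l m" using J_upper kl J by blast
      have ik: "le i k" using kl(1,2) M_meets by (metis cut_def)
      have il: "le i l" using kl(3,4) M_meets by (metis cut_def)
      have IJ: "k \<in> I" "l \<in> I" "m \<in> I" using kl m J by auto
      obtain y where y: "y \<in> M m" "y \<in> Q m" using M_meets[OF m(1)] by blast
      have yt: "y \<in> topspace (X m)" using y M_sub IJ by blast
      have im: "le i m" using ik m IJ i le_trans by blast
      have "p k m y \<in> M k \<inter> Q k" "p l m y \<in> M l \<inter> Q l"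
        using pM pQ m kl y IJ by blast+
      then have "p i k (p k m y) \<notin> A" "p i l (p l m y) \<notin> B"
        using kl ik il IJ by (auto simp: cut_def)
      then have "p i m y \<notin> A \<union> B"
        using p_comp[OF i _ IJ(3) _ _ yt] IJ ik il m by simp
      then show False using AB pM[OF i IJ(3) im y(1)] by blast
    qed
  qed

  have dense: "X i closure_of (p i j ` M j) = M i" if ij: "i \<in> I" "j \<in> I" "le i j" for i j
  proof -
    \<comment> \<open>The images of the \<open>M k\<close> in \<open>M i\<close> shrink as \<open>k\<close> grows. All of them have to be intersected:
      shrinking \<open>M i\<close> to the closure of the single image of \<open>M j\<close> need not leave a system.\<close>
    define G where "G i = (if i \<in> I then \<Inter>k\<in>{k\<in>I. le i k}. X i closure_of (p i k ` M k) else M i)"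
      for i
    have step: "p i l ` M l \<subseteq> p i k ` M k" if "i \<in> I" "k \<in> I" "l \<in> I" "le i k" "le k l" for i k l
    proof
      fix y assume "y \<in> p i l ` M l"
      then obtain x where x: "x \<in> M l" "y = p i l x" by blast
      then have "y = p i k (p k l x)" using p_comp that M_sub by (metis subsetD)
      then show "y \<in> p i k ` M k" using x pM that by blast
    qed
    have "good G" unfolding good_def
    proof (intro conjI ballI impI)
      fix i assume i: "i \<in> I"
      then show "closedin (X i) (G i)"
        unfolding G_def using le_refl by (auto intro!: closedin_INT)
    next
      fix j k assume jk: "j \<in> I" "k \<in> I" "le j k"
      show "p j k ` G k \<subseteq> G j"
      proof
        fix y assume "y \<in> p j k ` G k"
        then obtain x where x: "x \<in> G k" "y = p j k x" by blast
        have "y \<in> X j closure_of (p j m ` M m)" if m: "m \<in> I" "le j m" for m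
        proof -
          obtain l where l: "l \<in> I" "le k l" "le m l" using upper_bound[OF jk(2) m(1)] by blast
          have "x \<in> X k closure_of (p k l ` M l)" using x l jk by (auto simp: G_def)
          then have "y \<in> X j closure_of (p j k ` (p k l ` M l))"
            using continuous_map_image_closure_subset[OF p_cont[OF jk]] x by blast
          moreover have "p j k ` (p k l ` M l) = p j l ` M l"
            unfolding image_image by (rule image_cong) (use p_comp jk l M_sub in blast)+
          moreover have "p j l ` M l \<subseteq> p j m ` M m" using step jk m l by blast
          ultimately show ?thesis using closure_of_mono by (metis subsetD)
        qed
        then show "y \<in> G j" using jk by (auto simp: G_def)
      qed
    next
      fix j assume j: "j \<in> J"
      then have jI: "j \<in> I" using J by blast
      have "(\<Inter>k\<in>{k\<in>I. le j k}. X j closure_of (p j k ` M k)) \<inter> Q j \<noteq> {}"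
      proof (rule compactin_Inter_directed)
        show "compactin (X j) (Q j)" using Q j by (simp add: compact_saturated_in_def)
        show "{k \<in> I. le j k} \<noteq> {}" using jI le_refl by blast
        fix k assume k: "k \<in> {k \<in> I. le j k}"
        show "closedin (X j) (X j closure_of (p j k ` M k))" by simp
        obtain m where m: "m \<in> J" "le j m" "le k m" using J_upper jI k by blast
        obtain y where y: "y \<in> M m" "y \<in> Q m" using M_meets[OF m(1)] by blast
        have "p j m ` M m \<subseteq> p j k ` M k" using step jI k m J by blast
        also have "\<dots> \<subseteq> X j closure_of (p j k ` M k)"
          using p_topspace jI k M_sub by (intro closure_of_subset) blast
        finally show "X j closure_of (p j k ` M k) \<inter> Q j \<noteq> {}"
          using pQ[OF j m(1,2)] y by blast
      next
        fix k l assume kl: "k \<in> {k \<in> I. le j k}" "l \<in> {k \<in> I. le j k}"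
        obtain m where m: "m \<in> I" "le k m" "le l m" using upper_bound[of k l] kl by blast
        then have "le j m" using le_trans[of j k m] kl jI by blast
        moreover have "p j m ` M m \<subseteq> p j k ` M k" "p j m ` M m \<subseteq> p j l ` M l"
          using step jI kl m by blast+
        ultimately show "\<exists>m\<in>{k \<in> I. le j k}.
          X j closure_of (p j m ` M m) \<subseteq> X j closure_of (p j k ` M k) \<inter> X j closure_of (p j l ` M l)"
          using m by (intro bexI[of _ m] Int_greatest closure_of_mono) simp_all
      qed
      then show "G j \<inter> Q j \<noteq> {}" using jI by (simp add: G_def)
    qed
    have image_sub: "X i closure_of (p i k ` M k) \<subseteq> M i" if "i \<in> I" "k \<in> I" "le i k" for i k
      using pM that M_closed by (intro closure_of_minimal) auto
    have "G i \<subseteq> M i" for i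
      using image_sub[of i i] le_refl[of i] by (auto simp: G_def)
    then have "G = M" using minimal[OF \<open>good G\<close>] by (simp add: le_fun_def)
    then have "M i = G i" by simp
    also have "\<dots> \<subseteq> X i closure_of (p i j ` M j)" using ij by (auto simp: G_def)
    finally have "M i \<subseteq> X i closure_of (p i j ` M j)" .
    then show ?thesis using image_sub[OF ij] by blast
  qed

  have "\<exists>x\<in>topspace (X i). M i = X i closure_of {x}" if "i \<in> I" for i
    using sober irred that by (auto simp: sober_space_def)
  then obtain z where z: "\<And>i. i \<in> I \<Longrightarrow> z i \<in> topspace (X i) \<and> M i = X i closure_of {z i}"
    by metis
  have "restrict z I \<in> topspace L"
    using generic_points_thread[of z M] sober z dense by (auto simp: sober_space_def)
  moreover have "z i \<in> F i" if "i \<in> I" for i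
    using z[OF that] \<open>M \<le> F\<close> closure_of_subset[of "{z i}" "X i"] by (auto simp: le_fun_def)
  moreover have "z j \<in> Q j" if j: "j \<in> J" for j
  proof -
    obtain y where "y \<in> M j" "y \<in> Q j" using M_meets[OF j] by blast
    moreover from this have "spec_le (X j) y (z j)"
      using z j J by (auto simp: spec_le_closure_of)
    ultimately show ?thesis
      using Q[OF j] unfolding compact_saturated_in_def saturated_in_def by blast
  qed
  ultimately show thesis using that[of "restrict z I"] J by (auto simp: subset_iff)
qed

section \<open>The projections of a limit of sober spaces are proper\<close>

text \<open>The preimages of open sets under the projections form a base, and not just a subbase, of the
  limit, because finitely many indices have an upper bound.\<close>

lemma L_base:
  assumes U: "openin L U" and x: "x \<in> U"
  obtains k V where "k \<in> I" "openin (X k) V" "x k \<in> V" "{y \<in> topspace L. y k \<in> V} \<subseteq> U"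
proof -
  obtain T where T: "openin (product_topology X I) T" "U = T \<inter> topspace L"
    using U unfolding projective_limit_def openin_subtopology
    by (auto simp: topspace_subtopology Int_def)
  then obtain B where B: "finite {i \<in> I. B i \<noteq> topspace (X i)}" "\<forall>i\<in>I. openin (X i) (B i)"
      "x \<in> Pi\<^sub>E I B" "Pi\<^sub>E I B \<subseteq> T"
    using x unfolding openin_product_topology_alt by blast
  define K where "K = {i \<in> I. B i \<noteq> topspace (X i)}"
  have K: "finite K" "K \<subseteq> I" using B(1) by (auto simp: K_def)
  obtain k where k: "k \<in> I" "\<forall>i\<in>K. le i k" using finite_upper_bound[OF K] by blast
  have xL: "x \<in> topspace L" using x T by blast
  define V where "V = (\<Inter>i\<in>K. {y \<in> topspace (X k). p i k y \<in> B i}) \<inter> topspace (X k)"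
  have "openin (X k) V"
    unfolding V_def using K B(2) k
    by (intro openin_INT openin_continuous_map_preimage[OF p_cont]) auto
  moreover have "x k \<in> V"
    using xL k K B(3) L_component[OF xL] L_thread[OF xL] by (auto simp: V_def PiE_iff subset_iff)
  moreover have "{y \<in> topspace L. y k \<in> V} \<subseteq> U"
  proof
    fix y assume y: "y \<in> {y \<in> topspace L. y k \<in> V}"
    have "y i \<in> B i" if i: "i \<in> I" for i
    proof (cases "i \<in> K")
      case True
      then have "p i k (y k) \<in> B i" using y by (auto simp: V_def)
      then show ?thesis using L_thread[of y i k] y k True i by auto
    next
      case False
      then show ?thesis using i y L_component by (auto simp: K_def)
    qed
    then have "y \<in> Pi\<^sub>E I B" using y by (auto simp: topspace_L PiE_iff)
    then show "y \<in> U" using B T y by blast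
  qed
  ultimately show thesis using that k by blast
qed

text \<open>Membership in a closed set can be tested one coordinate at a time. For general products this is
  false (take a diagonal); here every basic open set restricts a single coordinate.\<close>

lemma in_L_closure_of:
  assumes x: "x \<in> topspace L"
    and A: "A \<subseteq> topspace L"
    and cl: "\<And>i. i \<in> I \<Longrightarrow> x i \<in> X i closure_of ((\<lambda>y. y i) ` A)"
  shows "x \<in> L closure_of A"
  unfolding in_closure_of
proof (intro conjI allI impI)
  fix T assume T: "x \<in> T \<and> openin L T"
  then obtain k V where V: "k \<in> I" "openin (X k) V" "x k \<in> V" "{y \<in> topspace L. y k \<in> V} \<subseteq> T"
    using L_base by blast
  then obtain y where "y \<in> A" "y k \<in> V" using cl[OF V(1)] by (auto simp: in_closure_of)
  then show "\<exists>y. y \<in> A \<and> y \<in> T" using V A by blast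
qed (fact x)

lemma p_proj_image:
  assumes "A \<subseteq> topspace L" "i \<in> I" "j \<in> I" "le i j"
  shows "p i j ` ((\<lambda>y. y j) ` A) = (\<lambda>y. y i) ` A"
  unfolding image_image by (rule image_cong) (use assms L_thread in blast)+

text \<open>Both halves of properness of \<open>x \<mapsto> x i\<close> assert that points exist in an intersection of closed
  subsets of the limit, over a compact saturated set \<open>Q\<close>; here it is enough to see this in each
  \<open>X j\<close> above \<open>X i\<close> separately. A single closed set \<open>F\<close>, with \<open>Q = \<up>x\<close>, gives that \<open>\<down>\<close> of its image is closed;
  a general family gives that the preimage of \<open>Q\<close> is compact.\<close>

lemma limit_point_over_compact_saturated:
  assumes proper: "\<And>i j. i \<in> I \<Longrightarrow> j \<in> I \<Longrightarrow> le i j \<Longrightarrow> proper_continuous_map (X j) (X i) (p i j)"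
    and sober: "\<And>i. i \<in> I \<Longrightarrow> sober_space (X i)"
    and i: "i \<in> I" and Q: "compact_saturated_in (X i) Q"
    and ne: "\<C> \<noteq> {}"
    and closed: "\<And>C. C \<in> \<C> \<Longrightarrow> closedin L C"
    and dir: "\<And>C D. C \<in> \<C> \<Longrightarrow> D \<in> \<C> \<Longrightarrow> \<exists>E\<in>\<C>. E \<subseteq> C \<inter> D"
    and meets: "\<And>C j. C \<in> \<C> \<Longrightarrow> j \<in> I \<Longrightarrow> le i j \<Longrightarrow>
       \<exists>y \<in> X j closure_of ((\<lambda>x. x j) ` C). p i j y \<in> Q"
  obtains z where "z \<in> \<Inter>\<C>" "z \<in> topspace L" "z i \<in> Q"
proof -
  let ?J = "{j \<in> I. le i j}"
  define R where "R j = {x \<in> topspace (X j). p i j x \<in> Q}" for j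
  define F where "F j = (\<Inter>C\<in>\<C>. X j closure_of ((\<lambda>x. x j) ` C))" for j
  have CL: "C \<subseteq> topspace L" if "C \<in> \<C>" for C using closed[OF that] closedin_subset by blast
  have R: "compact_saturated_in (X j) (R j)" if "j \<in> ?J" for j
    using proper[of i j] Q i that by (auto simp: R_def proper_continuous_map_def)
  obtain z where z: "z \<in> topspace L" "\<And>j. j \<in> I \<Longrightarrow> z j \<in> F j" "\<And>j. j \<in> ?J \<Longrightarrow> z j \<in> R j"
  proof (rule thread_in_compact_saturated[of ?J R F])
    show "sober_space (X j)" if "j \<in> I" for j using sober that .
    show "?J \<subseteq> I" by blast
    show "\<exists>k\<in>?J. le j k" if "j \<in> I" for j using upper_bound[OF i that] by blast
    show "compact_saturated_in (X j) (R j)" if "j \<in> ?J" for j using R that .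
    show "p j k ` R k \<subseteq> R j" if "j \<in> ?J" "k \<in> ?J" "le j k" for j k
      using that i p_comp p_topspace by (auto simp: R_def)
    show "closedin (X j) (F j)" if "j \<in> I" for j
      unfolding F_def using ne by (intro closedin_INT) auto
    show "p j k ` F k \<subseteq> F j" if jk: "j \<in> I" "k \<in> I" "le j k" for j k
    proof -
      have "p j k ` (X k closure_of ((\<lambda>x. x k) ` C)) \<subseteq> X j closure_of ((\<lambda>x. x j) ` C)"
        if "C \<in> \<C>" for C
        using continuous_map_image_closure_subset[OF p_cont[OF jk], of "(\<lambda>x. x k) ` C"]
        by (simp only: p_proj_image[OF CL[OF that] jk])
      then show ?thesis unfolding F_def by blast
    qed
    show "F j \<inter> R j \<noteq> {}" if j: "j \<in> ?J" for j
      unfolding F_def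
    proof (rule compactin_Inter_directed)
      show "compactin (X j) (R j)" using R[OF j] by (simp add: compact_saturated_in_def)
      show "\<exists>E\<in>\<C>. X j closure_of (\<lambda>x. x j) ` E
          \<subseteq> X j closure_of (\<lambda>x. x j) ` C \<inter> X j closure_of (\<lambda>x. x j) ` D"
        if CD: "C \<in> \<C>" "D \<in> \<C>" for C D
      proof -
        obtain E where "E \<in> \<C>" "E \<subseteq> C" "E \<subseteq> D" using dir[OF CD] by blast
        then show ?thesis by (intro bexI[of _ E] Int_greatest closure_of_mono image_mono)
      qed
      show "X j closure_of (\<lambda>x. x j) ` C \<inter> R j \<noteq> {}" if "C \<in> \<C>" for C
        using meets[OF that, of j] j closure_of_subset_topspace[of "X j"] by (auto simp: R_def)
    qed (use ne in auto)
  qed blast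
  have "z \<in> C" if C: "C \<in> \<C>" for C
  proof -
    have "z \<in> L closure_of C"
      using z C CL by (intro in_L_closure_of) (auto simp: F_def)
    then show ?thesis using closed[OF C] by (simp add: closure_of_closedin)
  qed
  moreover have "z i \<in> Q"
    using z(3)[of i] i le_refl L_thread[OF z(1) i i] by (auto simp: R_def)
  ultimately show thesis using that z(1) by blast
qed

lemma proper_projection:
  assumes proper: "\<And>i j. i \<in> I \<Longrightarrow> j \<in> I \<Longrightarrow> le i j \<Longrightarrow> proper_continuous_map (X j) (X i) (p i j)"
    and sober: "\<And>i. i \<in> I \<Longrightarrow> sober_space (X i)"
    and i: "i \<in> I"
  shows "proper_continuous_map L (X i) (\<lambda>x. x i)"
  unfolding proper_continuous_map_def
proof (intro conjI allI impI)
  show "continuous_map L (X i) (\<lambda>x. x i)" using proj_cont[OF i] .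
next
  fix F assume F: "closedin L F"
  then have FL: "F \<subseteq> topspace L" by (rule closedin_subset)
  have "down_closure (X i) ((\<lambda>x. x i) ` F) = X i closure_of ((\<lambda>x. x i) ` F)"
  proof
    show "down_closure (X i) ((\<lambda>x. x i) ` F) \<subseteq> X i closure_of ((\<lambda>x. x i) ` F)"
      unfolding down_closure_def spec_le_def subset_eq in_closure_of by blast
    show "X i closure_of ((\<lambda>x. x i) ` F) \<subseteq> down_closure (X i) ((\<lambda>x. x i) ` F)"
    proof
      fix x assume x: "x \<in> X i closure_of ((\<lambda>x. x i) ` F)"
      have xt: "x \<in> topspace (X i)" using x by (simp add: in_closure_of)
      have meets: "\<exists>y \<in> X j closure_of ((\<lambda>x. x j) ` F). p i j y \<in> {y. spec_le (X i) x y}"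
        if j: "j \<in> I" "le i j" for j
      proof -
        let ?G = "X j closure_of ((\<lambda>x. x j) ` F)"
        have "(\<lambda>x. x j) ` F \<subseteq> ?G" using FL L_component j by (intro closure_of_subset) blast
        then have sub: "(\<lambda>x. x i) ` F \<subseteq> p i j ` ?G"
          using p_proj_image[OF FL i j] by blast
        have "p i j ` ?G \<subseteq> down_closure (X i) (p i j ` ?G)"
          using p_topspace i j closure_of_subset_topspace[of "X j"] spec_le_refl
          by (fastforce simp: down_closure_def)
        moreover have "closedin (X i) (down_closure (X i) (p i j ` ?G))"
          using proper[OF i j] by (simp add: proper_continuous_map_def)
        ultimately have "X i closure_of ((\<lambda>x. x i) ` F) \<subseteq> down_closure (X i) (p i j ` ?G)"
          using sub by (intro closure_of_minimal) auto
        then show ?thesis using x by (auto simp: down_closure_def)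
      qed
      obtain z where "z \<in> \<Inter>{F}" "z i \<in> {y. spec_le (X i) x y}"
        using limit_point_over_compact_saturated
          [OF proper sober i compact_saturated_in_up[OF xt], of "{F}"] F meets by auto
      then show "x \<in> down_closure (X i) ((\<lambda>x. x i) ` F)" by (auto simp: down_closure_def)
    qed
  qed
  then show "closedin (X i) (down_closure (X i) ((\<lambda>x. x i) ` F))" by simp
next
  fix Q assume Q: "compact_saturated_in (X i) Q"
  let ?P = "{x \<in> topspace L. x i \<in> Q}"
  have "compactin L ?P"
    unfolding compactin_fip
  proof (intro conjI allI impI)
    show "?P \<subseteq> topspace L" by blast
    fix \<U> assume U: "(\<forall>C\<in>\<U>. closedin L C) \<and> (\<forall>\<F>. finite \<F> \<and> \<F> \<subseteq> \<U> \<longrightarrow> ?P \<inter> \<Inter>\<F> \<noteq> {})"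
    \<comment> \<open>Intersecting with the whole space makes the empty finite subfamily harmless.\<close>
    let ?\<C> = "{topspace L \<inter> \<Inter>\<F> |\<F>. finite \<F> \<and> \<F> \<subseteq> \<U>}"
    obtain z where z: "z \<in> \<Inter>?\<C>" "z \<in> topspace L" "z i \<in> Q"
    proof (rule limit_point_over_compact_saturated[OF proper sober i Q, of ?\<C>])
      show "?\<C> \<noteq> {}" by blast
      show "closedin L C" if C: "C \<in> ?\<C>" for C
      proof -
        obtain \<F> where F: "C = topspace L \<inter> \<Inter>\<F>" "\<F> \<subseteq> \<U>" using C by blast
        show ?thesis
        proof (cases "\<F> = {}")
          case False
          then show ?thesis using F U by (auto intro!: closedin_Int closedin_Inter)
        qed (simp add: F)
      qed
      show "\<exists>E\<in>?\<C>. E \<subseteq> C \<inter> D" if CD: "C \<in> ?\<C>" "D \<in> ?\<C>" for C D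
      proof -
        obtain \<F> \<G> where "C = topspace L \<inter> \<Inter>\<F>" "D = topspace L \<inter> \<Inter>\<G>"
            "finite (\<F> \<union> \<G>)" "\<F> \<union> \<G> \<subseteq> \<U>" using CD by auto
        then show ?thesis by (intro bexI[of _ "topspace L \<inter> \<Inter>(\<F> \<union> \<G>)"]) blast+
      qed
      show "\<exists>y \<in> X j closure_of ((\<lambda>x. x j) ` C). p i j y \<in> Q"
        if C: "C \<in> ?\<C>" and j: "j \<in> I" "le i j" for C j
      proof -
        obtain \<F> where F: "C = topspace L \<inter> \<Inter>\<F>" "finite \<F>" "\<F> \<subseteq> \<U>" using C by blast
        then obtain x where x: "x \<in> topspace L" "x i \<in> Q" "x \<in> C" using U by blast
        have "(\<lambda>x. x j) ` C \<subseteq> X j closure_of ((\<lambda>x. x j) ` C)"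
          using F L_component j by (intro closure_of_subset) blast
        then show ?thesis using x L_thread[OF x(1) i j] by (intro bexI[of _ "x j"]) auto
      qed
    qed blast
    have "z \<in> C" if "C \<in> \<U>" for C
    proof -
      have "topspace L \<inter> \<Inter>{C} \<in> ?\<C>" using that by (intro CollectI exI[of _ "{C}"]) auto
      then show ?thesis using z(1) by blast
    qed
    then show "?P \<inter> \<Inter>\<U> \<noteq> {}" using z by blast
  qed
  then show "compact_saturated_in L ?P"
    using saturated_in_preimage[OF proj_cont[OF i]] Q by (simp add: compact_saturated_in_def)
qed

section \<open>Limits of sober spaces are sober\<close>

lemma sober_projective_limit:
  assumes sober: "\<And>i. i \<in> I \<Longrightarrow> sober_space (X i)"
  shows "sober_space L"
  unfolding sober_space_def
proof (intro conjI allI impI)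
  have t0: "t0_space (X i)" if "i \<in> I" for i using sober that by (simp add: sober_space_def)
  show "t0_space L"
    unfolding projective_limit_def
    by (intro t0_space_subtopology) (use t0 in \<open>auto simp: t0_space_product_topology\<close>)
  fix C assume C: "irreducible_closed_in L C"
  then have CL: "C \<subseteq> topspace L" and C_closed: "closedin L C"
    using closedin_subset by (auto simp: irreducible_closed_in_def)
  let ?F = "\<lambda>i. X i closure_of ((\<lambda>x. x i) ` C)"
  have sub: "(\<lambda>x. x i) ` C \<subseteq> ?F i" if "i \<in> I" for i
    using CL L_component that by (intro closure_of_subset) blast
  have "irreducible_closed_in (X i) (?F i)" if i: "i \<in> I" for i
    unfolding irreducible_closed_in_def
  proof (intro conjI allI impI)
    show "?F i \<noteq> {}" using sub[OF i] C by (auto simp: irreducible_closed_in_def)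
    fix A B assume AB: "closedin (X i) A \<and> closedin (X i) B \<and> ?F i \<subseteq> A \<union> B"
    let ?pre = "\<lambda>A. {x \<in> topspace L. x i \<in> A}"
    have "closedin L (?pre A)" "closedin L (?pre B)"
      using AB closedin_continuous_map_preimage[OF proj_cont[OF i]] by auto
    moreover have "C \<subseteq> ?pre A \<union> ?pre B" using AB sub[OF i] CL by blast
    ultimately have "C \<subseteq> ?pre A \<or> C \<subseteq> ?pre B"
      using C unfolding irreducible_closed_in_def by blast
    then show "?F i \<subseteq> A \<or> ?F i \<subseteq> B"
      using AB closure_of_minimal[of "(\<lambda>x. x i) ` C"] by blast
  qed simp
  then have "\<exists>x\<in>topspace (X i). ?F i = X i closure_of {x}" if "i \<in> I" for i
    using sober that by (auto simp: sober_space_def)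
  then obtain z where z: "\<And>i. i \<in> I \<Longrightarrow> z i \<in> topspace (X i) \<and> ?F i = X i closure_of {z i}"
    by metis
  let ?z = "restrict z I"
  have zL: "?z \<in> topspace L"
  proof (rule generic_points_thread[of z ?F, OF t0])
    show "X i closure_of (p i j ` ?F j) = ?F i" if ij: "i \<in> I" "j \<in> I" "le i j" for i j
    proof -
      have "X i closure_of (p i j ` ?F j) = X i closure_of (p i j ` ((\<lambda>x. x j) ` C))"
        using CL L_component ij by (intro closure_of_image_closure_of[OF p_cont]) auto
      then show ?thesis by (simp only: p_proj_image[OF CL ij])
    qed
  qed (use z in auto)
  have "z i \<in> ?F i" if "i \<in> I" for i
    using z[OF that] closure_of_subset[of "{z i}" "X i"] by auto
  then have "?z \<in> L closure_of C"
    using zL CL by (intro in_L_closure_of) auto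
  then have "?z \<in> C" using C_closed by (simp add: closure_of_closedin)
  moreover have "x \<in> L closure_of {?z}" if "x \<in> C" for x
  proof (rule in_L_closure_of)
    show "x i \<in> X i closure_of ((\<lambda>y. y i) ` {?z})" if "i \<in> I" for i
      using sub[OF that] z[OF that] \<open>x \<in> C\<close> that by auto
  qed (use that CL zL in auto)
  ultimately have "C = L closure_of {?z}"
    using closure_of_minimal[of "{?z}" C L] C_closed by blast
  then show "\<exists>x\<in>topspace L. C = L closure_of {x}" using zL by blast
qed

end

section \<open>Copowers\<close>

lemma openin_copower_slice:
  assumes "m < n" "openin X U"
  shows "openin (copower n X) ({m} \<times> U)"
proof -
  have "{m} \<times> U = Pair m ` U" by auto
  then show ?thesis
    using assms open_map_component_injection[of m "{..<n}" "\<lambda>_. X"]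
    by (auto simp: copower_def open_map_def)
qed

lemma closedin_copower_slice:
  assumes "m < n" "closedin X U"
  shows "closedin (copower n X) ({m} \<times> U)"
proof -
  have "{m} \<times> U = Pair m ` U" by auto
  then show ?thesis
    using assms closed_map_component_injection[of m "{..<n}" "\<lambda>_. X"]
    by (auto simp: copower_def closed_map_def)
qed

lemma spec_le_copower:
  "spec_le (copower n X) (m, x) (l, y) \<longleftrightarrow> m = l \<and> m < n \<and> spec_le X x y"
proof
  assume *: "spec_le (copower n X) (m, x) (l, y)"
  have mn: "m < n" "x \<in> topspace X" "l < n" "y \<in> topspace X"
    using * by (auto simp: spec_le_def copower_def)
  have slice: "l = m \<and> y \<in> U" if "openin X U" "x \<in> U" for U
  proof -
    have "openin (copower n X) ({m} \<times> U)"
      using that(1) mn by (intro openin_copower_slice)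
    then have "(l, y) \<in> {m} \<times> U" using * that(2) unfolding spec_le_def by blast
    then show ?thesis by simp
  qed
  then show "m = l \<and> m < n \<and> spec_le X x y"
    using mn slice[OF openin_topspace] by (auto simp: spec_le_def)
next
  assume "m = l \<and> m < n \<and> spec_le X x y"
  then show "spec_le (copower n X) (m, x) (l, y)"
    by (auto simp: spec_le_def copower_def openin_sum_topology)
qed

lemma continuous_map_snd_copower: "continuous_map (copower n X) X snd"
proof -
  have "openin (copower n X) {x \<in> topspace (copower n X). snd x \<in> U}" if "openin X U" for U
    using that openin_subset[OF that]
    by (auto simp: copower_def openin_sum_topology Collect_conj_eq Int_absorb1 openin_Int)
  then show ?thesis by (auto simp: continuous_map_def copower_def)
qed

lemma compactin_copower:
  "compactin (copower n X) Q \<longleftrightarrow>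
     Q \<subseteq> {..<n} \<times> topspace X \<and> (\<forall>m<n. compactin X {x. (m, x) \<in> Q})"
proof
  assume Q: "compactin (copower n X) Q"
  then have sub: "Q \<subseteq> {..<n} \<times> topspace X"
    using compactin_subset_topspace[OF Q] by (auto simp: copower_def)
  moreover have "compactin X {x. (m, x) \<in> Q}" if "m < n" for m
  proof -
    have "closedin (copower n X) ({m} \<times> topspace X)"
      using that by (intro closedin_copower_slice) auto
    then have "compactin X (snd ` ({m} \<times> topspace X \<inter> Q))"
      using Q continuous_map_snd_copower by (intro image_compactin closed_Int_compactin)
    moreover have "snd ` ({m} \<times> topspace X \<inter> Q) = {x. (m, x) \<in> Q}"
      using sub by force
    ultimately show ?thesis by simp
  qed
  ultimately show "Q \<subseteq> {..<n} \<times> topspace X \<and> (\<forall>m<n. compactin X {x. (m, x) \<in> Q})"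
    by blast
next
  assume *: "Q \<subseteq> {..<n} \<times> topspace X \<and> (\<forall>m<n. compactin X {x. (m, x) \<in> Q})"
  have "compactin (copower n X) (\<Union>m\<in>{..<n}. Pair m ` {x. (m, x) \<in> Q})"
    unfolding copower_def
    using * by (intro compactin_Union) (auto intro!: image_compactin continuous_map_component_injection)
  moreover have "(\<Union>m\<in>{..<n}. Pair m ` {x. (m, x) \<in> Q}) = Q" using * by auto
  ultimately show "compactin (copower n X) Q" by simp
qed

lemma compact_saturated_in_copower:
  "compact_saturated_in (copower n X) Q \<longleftrightarrow>
     Q \<subseteq> {..<n} \<times> topspace X \<and> (\<forall>m<n. compact_saturated_in X {x. (m, x) \<in> Q})"
proof -
  have "saturated_in (copower n X) Q \<longleftrightarrow> (\<forall>m<n. saturated_in X {x. (m, x) \<in> Q})"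
    if "Q \<subseteq> {..<n} \<times> topspace X"
  proof -
    have "topspace (copower n X) = {..<n} \<times> topspace X" by (auto simp: copower_def)
    then show ?thesis
      using that unfolding saturated_in_def by (auto simp: spec_le_copower)
  qed
  then show ?thesis unfolding compact_saturated_in_def compactin_copower by blast
qed

lemma proper_copower:
  assumes "proper_continuous_map X Y f"
  shows "proper_continuous_map (copower n X) (copower n Y) (map_prod id f)"
  unfolding proper_continuous_map_def
proof (intro conjI allI impI)
  have f: "continuous_map X Y f" using assms by (simp add: proper_continuous_map_def)
  then have fY: "f x \<in> topspace Y" if "x \<in> topspace X" for x
    using continuous_map_image_subset_topspace[OF f] that by blast
  show "continuous_map (copower n X) (copower n Y) (map_prod id f)"
    unfolding continuous_map_def
  proof (intro conjI allI impI)
    show "map_prod id f \<in> topspace (copower n X) \<rightarrow> topspace (copower n Y)"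
      using fY by (auto simp: copower_def)
    fix U assume "openin (copower n Y) U"
    then have "openin X {x \<in> topspace X. f x \<in> {y. (m, y) \<in> U}}" if "m < n" for m
      using that openin_continuous_map_preimage[OF f, of "{y. (m, y) \<in> U}"]
      by (simp add: copower_def openin_sum_topology)
    then show "openin (copower n X) {x \<in> topspace (copower n X). map_prod id f x \<in> U}"
      by (auto simp: copower_def openin_sum_topology)
  qed
next
  fix F assume F: "closedin (copower n X) F"
  let ?D = "down_closure (copower n Y) (map_prod id f ` F)"
  have "{y. (m, y) \<in> ?D} = down_closure Y (f ` {x. (m, x) \<in> F})" if "m < n" for m
    using that by (force simp: down_closure_def spec_le_copower)
  moreover have "closedin Y (down_closure Y (f ` {x. (m, x) \<in> F}))" if "m < n" for m
    using assms F that by (auto simp: proper_continuous_map_def copower_def closedin_sum_topology)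
  moreover have "?D \<subseteq> topspace (copower n Y)" by (auto simp: down_closure_def spec_le_def)
  ultimately show "closedin (copower n Y) ?D"
    by (simp add: copower_def closedin_sum_topology)
next
  fix Q assume "compact_saturated_in (copower n Y) Q"
  then have "compact_saturated_in X {x \<in> topspace X. f x \<in> {y. (m, y) \<in> Q}}" if "m < n" for m
    using assms that unfolding proper_continuous_map_def compact_saturated_in_copower by blast
  then show "compact_saturated_in (copower n X) {x \<in> topspace (copower n X). map_prod id f x \<in> Q}"
    unfolding compact_saturated_in_copower by (auto simp: copower_def)
qed

section \<open>Consonance pulls back along a directed family of proper maps\<close>

text \<open>The witness is the complement of \<open>\<down>f[X - W]\<close>, which is open by properness. It contains \<open>Q\<close>: a
  point of \<open>Q\<close> below \<open>f x\<close> forces \<open>f x \<in> Q\<close>, as \<open>Q\<close> is saturated, and then \<open>x \<in> W\<close>.\<close>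

lemma proper_preimage_neighborhood:
  assumes f: "proper_continuous_map X Y f" and Q: "saturated_in Y Q"
    and W: "openin X W" and sub: "{x \<in> topspace X. f x \<in> Q} \<subseteq> W"
  obtains V where "openin Y V" "Q \<subseteq> V" "{x \<in> topspace X. f x \<in> V} \<subseteq> W"
proof
  let ?D = "down_closure Y (f ` (topspace X - W))"
  have fY: "f x \<in> topspace Y" if "x \<in> topspace X" for x
    using continuous_map_image_subset_topspace[of X Y f] f that
    by (auto simp: proper_continuous_map_def)
  show "openin Y (topspace Y - ?D)"
    using f W unfolding proper_continuous_map_def
    by (intro openin_diff openin_topspace) blast
  show "Q \<subseteq> topspace Y - ?D"
    using Q sub unfolding saturated_in_def down_closure_def by blast
  show "{x \<in> topspace X. f x \<in> topspace Y - ?D} \<subseteq> W"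
    using spec_le_refl[OF fY] by (auto simp: down_closure_def)
qed

lemma scott_open_opens_directed:
  assumes "scott_open_opens X \<U>" "\<D> \<subseteq> {U. openin X U}" "directed_under (\<subseteq>) \<D>" "\<Union>\<D> \<in> \<U>"
  shows "\<D> \<inter> \<U> \<noteq> {}"
  using assms unfolding scott_open_opens_def by simp

lemma scott_open_opens_preimage:
  assumes f: "continuous_map X Y f" and U: "scott_open_opens X \<U>"
  shows "scott_open_opens Y {V. openin Y V \<and> {x \<in> topspace X. f x \<in> V} \<in> \<U>}"
    (is "scott_open_opens Y ?\<V>")
  unfolding scott_open_opens_def
proof (intro conjI allI impI)
  let ?pre = "\<lambda>V. {x \<in> topspace X. f x \<in> V}"
  have pre_open: "openin X (?pre V)" if "openin Y V" for V
    using openin_continuous_map_preimage[OF f that] .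
  show "V \<in> ?\<V>" if V: "A \<in> ?\<V> \<and> openin Y V \<and> A \<subseteq> V" for A V
  proof -
    have "?pre A \<in> \<U>" "openin X (?pre V)" "?pre A \<subseteq> ?pre V" using V pre_open by auto
    then have "?pre V \<in> \<U>" using U unfolding scott_open_opens_def by blast
    then show ?thesis using V by blast
  qed
  fix \<D> assume D: "\<D> \<subseteq> {U. openin Y U} \<and> directed_under (\<subseteq>) \<D> \<and> \<Union>\<D> \<in> ?\<V>"
  have "directed_under (\<subseteq>) (?pre ` \<D>)"
    unfolding directed_under_def
  proof (intro conjI ballI)
    show "?pre ` \<D> \<noteq> {}" using D by (auto simp: directed_under_def)
    fix A B assume "A \<in> ?pre ` \<D>" "B \<in> ?pre ` \<D>"
    then obtain A' B' where AB: "A' \<in> \<D>" "A = ?pre A'" "B' \<in> \<D>" "B = ?pre B'" by blast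
    then obtain C where "C \<in> \<D>" "A' \<subseteq> C" "B' \<subseteq> C"
      using D unfolding directed_under_def by blast
    then show "\<exists>C\<in>?pre ` \<D>. A \<subseteq> C \<and> B \<subseteq> C"
      using AB by (intro bexI[of _ "?pre C"]) auto
  qed
  moreover have "\<Union>(?pre ` \<D>) = ?pre (\<Union>\<D>)" by blast
  moreover have "?pre ` \<D> \<subseteq> {U. openin X U}" using D pre_open by blast
  ultimately have "?pre ` \<D> \<inter> \<U> \<noteq> {}"
    using D by (intro scott_open_opens_directed[OF U]) simp_all
  then show "\<D> \<inter> ?\<V> \<noteq> {}" using D by blast
qed auto

text \<open>The assumption \<open>factor\<close> says that any two of the maps factor through a third one of the family.
  It makes the preimages of open sets closed under binary unions, so that those contained in a
  given open set are a directed family.\<close>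

lemma consonant_space_if_proper_family:
  fixes Z :: "'z topology" and Y :: "'i \<Rightarrow> 'y topology" and f :: "'i \<Rightarrow> 'z \<Rightarrow> 'y"
  assumes ne: "I \<noteq> {}"
    and proper: "\<And>i. i \<in> I \<Longrightarrow> proper_continuous_map Z (Y i) (f i)"
    and consonant: "\<And>i. i \<in> I \<Longrightarrow> consonant_space (Y i)"
    and factor: "\<And>i j. i \<in> I \<Longrightarrow> j \<in> I \<Longrightarrow> \<exists>k\<in>I. \<exists>g h.
        continuous_map (Y k) (Y i) g \<and> (\<forall>z\<in>topspace Z. f i z = g (f k z)) \<and>
        continuous_map (Y k) (Y j) h \<and> (\<forall>z\<in>topspace Z. f j z = h (f k z))"
    and base: "\<And>U z. openin Z U \<Longrightarrow> z \<in> U \<Longrightarrow>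
        \<exists>i\<in>I. \<exists>V. openin (Y i) V \<and> f i z \<in> V \<and> {y \<in> topspace Z. f i y \<in> V} \<subseteq> U"
  shows "consonant_space Z"
  unfolding consonant_space_def
proof (intro allI impI)
  fix \<U> U assume *: "scott_open_opens Z \<U> \<and> U \<in> \<U>"
  then have U: "openin Z U" unfolding scott_open_opens_def by blast
  let ?pre = "\<lambda>i V. {z \<in> topspace Z. f i z \<in> V}"
  have cont: "continuous_map Z (Y i) (f i)" if "i \<in> I" for i
    using proper[OF that] by (simp add: proper_continuous_map_def)
  have f_topspace: "f i z \<in> topspace (Y i)" if "i \<in> I" "z \<in> topspace Z" for i z
    using continuous_map_image_subset_topspace[OF cont[OF that(1)]] that(2) by blast
  let ?\<D> = "{?pre i V |i V. i \<in> I \<and> openin (Y i) V \<and> ?pre i V \<subseteq> U}"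
  have "directed_under (\<subseteq>) ?\<D>"
    unfolding directed_under_def
  proof (intro conjI ballI)
    obtain i where "i \<in> I" using ne by blast
    then have "?pre i {} \<in> ?\<D>" by (intro CollectI exI[of _ i] exI[of _ "{}"]) auto
    then show "?\<D> \<noteq> {}" by blast
    fix A B assume "A \<in> ?\<D>" "B \<in> ?\<D>"
    then obtain i V j W where iV: "i \<in> I" "openin (Y i) V" "A = ?pre i V" "A \<subseteq> U"
      and jW: "j \<in> I" "openin (Y j) W" "B = ?pre j W" "B \<subseteq> U" by blast
    obtain k g h where k: "k \<in> I"
      and g: "continuous_map (Y k) (Y i) g" "\<forall>z\<in>topspace Z. f i z = g (f k z)"
      and h: "continuous_map (Y k) (Y j) h" "\<forall>z\<in>topspace Z. f j z = h (f k z)"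
      using factor[OF iV(1) jW(1)] by blast
    let ?T = "{y \<in> topspace (Y k). g y \<in> V} \<union> {y \<in> topspace (Y k). h y \<in> W}"
    have "openin (Y k) ?T"
      using g h iV jW by (intro openin_Un openin_continuous_map_preimage)
    moreover have "?pre k ?T = A \<union> B"
      using iV jW g h f_topspace[OF k] by auto
    ultimately have "A \<union> B \<in> ?\<D>"
      using k iV jW by (intro CollectI exI[of _ k] exI[of _ ?T]) auto
    then show "\<exists>C\<in>?\<D>. A \<subseteq> C \<and> B \<subseteq> C" by blast
  qed
  moreover have "\<Union>?\<D> = U"
  proof
    show "U \<subseteq> \<Union>?\<D>"
    proof
      fix z assume z: "z \<in> U"
      then obtain i V where "i \<in> I" "openin (Y i) V" "f i z \<in> V" "?pre i V \<subseteq> U"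
        using base[OF U] by blast
      then show "z \<in> \<Union>?\<D>"
        using z openin_subset[OF U] by (intro UnionI[of "?pre i V"]) auto
    qed
  qed blast
  moreover have "?\<D> \<subseteq> {U. openin Z U}"
    using openin_continuous_map_preimage[OF cont] by blast
  ultimately have "?\<D> \<inter> \<U> \<noteq> {}"
    using * by (intro scott_open_opens_directed[of Z]) (simp_all only:)
  then obtain i V where i: "i \<in> I" and V: "openin (Y i) V" "?pre i V \<subseteq> U" "?pre i V \<in> \<U>"
    by blast
  let ?\<V> = "{V. openin (Y i) V \<and> ?pre i V \<in> \<U>}"
  have "scott_open_opens (Y i) ?\<V>" "V \<in> ?\<V>"
    using scott_open_opens_preimage[OF cont[OF i]] * V by auto
  then obtain Q where Q: "compact_saturated_in (Y i) Q" "Q \<subseteq> V"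
      "\<And>T. openin (Y i) T \<Longrightarrow> Q \<subseteq> T \<Longrightarrow> T \<in> ?\<V>"
    using consonant[OF i] unfolding consonant_space_def by meson
  show "\<exists>Q. compact_saturated_in Z Q \<and> Q \<subseteq> U \<and> (\<forall>W. openin Z W \<and> Q \<subseteq> W \<longrightarrow> W \<in> \<U>)"
  proof (intro exI conjI allI impI)
    show "compact_saturated_in Z (?pre i Q)"
      using proper[OF i] Q(1) by (simp add: proper_continuous_map_def)
    show "?pre i Q \<subseteq> U" using V Q(2) by blast
    fix W assume W: "openin Z W \<and> ?pre i Q \<subseteq> W"
    have "saturated_in (Y i) Q" using Q(1) by (simp add: compact_saturated_in_def)
    then obtain T where "openin (Y i) T" "Q \<subseteq> T" "?pre i T \<subseteq> W"
      using proper_preimage_neighborhood[OF proper[OF i] _ conjunct1[OF W] conjunct2[OF W]] by blast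
    then have "?pre i T \<in> \<U>" "?pre i T \<subseteq> W" using Q(3) by auto
    then show "W \<in> \<U>" using * W unfolding scott_open_opens_def by blast
  qed
qed

context proj_system
begin

text \<open>A basic open set of \<open>n \<odot> L\<close> lives in a single summand \<open>m\<close>, where it is the preimage of some
  \<open>V \<subseteq> X k\<close>; in \<open>n \<odot> X k\<close> it comes from \<open>{m} \<times> V\<close>.\<close>

lemma odot_consonant_projective_limit:
  assumes proper: "\<And>i j. i \<in> I \<Longrightarrow> j \<in> I \<Longrightarrow> le i j \<Longrightarrow> proper_continuous_map (X j) (X i) (p i j)"
    and consonant: "\<And>i. i \<in> I \<Longrightarrow> odot_consonant_space (X i)"
    and sober: "\<And>i. i \<in> I \<Longrightarrow> sober_space (X i)"
  shows "odot_consonant_space L"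
  unfolding odot_consonant_space_def
proof
  fix n
  show "consonant_space (copower n L)"
  proof (rule consonant_space_if_proper_family[where
        Y = "\<lambda>i. copower n (X i)" and f = "\<lambda>i. map_prod id (\<lambda>x. x i)" and I = I])
    show "I \<noteq> {}" using sys by (auto simp: projective_system_def directed_under_def)
    show "proper_continuous_map (copower n L) (copower n (X i)) (map_prod id (\<lambda>x. x i))"
      if "i \<in> I" for i
      using proper_copower[OF proper_projection[OF proper sober that]] .
    show "consonant_space (copower n (X i))" if "i \<in> I" for i
      using consonant[OF that] by (simp add: odot_consonant_space_def)
  next
    fix i j assume ij: "i \<in> I" "j \<in> I"
    obtain k where k: "k \<in> I" "le i k" "le j k" using upper_bound[OF ij] by blast
    have "continuous_map (copower n (X k)) (copower n (X l)) (map_prod id (p l k)) \<and>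
        (\<forall>z\<in>topspace (copower n L).
           map_prod id (\<lambda>x. x l) z = map_prod id (p l k) (map_prod id (\<lambda>x. x k) z))"
      if l: "l \<in> I" "le l k" for l
    proof
      show "continuous_map (copower n (X k)) (copower n (X l)) (map_prod id (p l k))"
        using proper_copower[OF proper[OF l(1) k(1) l(2)]] by (simp add: proper_continuous_map_def)
      show "\<forall>z\<in>topspace (copower n L).
           map_prod id (\<lambda>x. x l) z = map_prod id (p l k) (map_prod id (\<lambda>x. x k) z)"
        using L_thread l k by (auto simp: copower_def)
    qed
    then show "\<exists>k\<in>I. \<exists>g h.
       continuous_map (copower n (X k)) (copower n (X i)) g \<and>
       (\<forall>z\<in>topspace (copower n L). map_prod id (\<lambda>x. x i) z = g (map_prod id (\<lambda>x. x k) z)) \<and>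
       continuous_map (copower n (X k)) (copower n (X j)) h \<and>
       (\<forall>z\<in>topspace (copower n L). map_prod id (\<lambda>x. x j) z = h (map_prod id (\<lambda>x. x k) z))"
      using ij k by blast
  next
    fix U z assume U: "openin (copower n L) U" "z \<in> U"
    obtain m x where z: "z = (m, x)" by fastforce
    then have m: "m < n" using U openin_subset[OF U(1)] by (auto simp: copower_def)
    then have "openin L {x. (m, x) \<in> U}" using U by (auto simp: copower_def openin_sum_topology)
    then obtain k V where V: "k \<in> I" "openin (X k) V" "x k \<in> V"
        "{y \<in> topspace L. y k \<in> V} \<subseteq> {x. (m, x) \<in> U}"
      using L_base[of "{x. (m, x) \<in> U}" x] U z by blast
    have "openin (copower n (X k)) ({m} \<times> V)"
      using V m by (intro openin_copower_slice)
    moreover have "{y \<in> topspace (copower n L). map_prod id (\<lambda>x. x k) y \<in> {m} \<times> V} \<subseteq> U"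
      using V by (auto simp: copower_def)
    ultimately show "\<exists>i\<in>I. \<exists>V. openin (copower n (X i)) V \<and> map_prod id (\<lambda>x. x i) z \<in> V \<and>
        {y \<in> topspace (copower n L). map_prod id (\<lambda>x. x i) y \<in> V} \<subseteq> U"
      using V z by (intro bexI[of _ k] exI[of _ "{m} \<times> V"]) auto
  qed
qed

end

theorem corollary12p15:
  fixes I :: "'i set"
    and le :: "'i \<Rightarrow> 'i \<Rightarrow> bool"
    and X :: "'i \<Rightarrow> 'a topology"
    and p :: "'i \<Rightarrow> 'i \<Rightarrow> 'a \<Rightarrow> 'a"
  assumes "projective_system I le X p"
    and "\<And>i j. i \<in> I \<Longrightarrow> j \<in> I \<Longrightarrow> le i j \<Longrightarrow> proper_continuous_map (X j) (X i) (p i j)"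
    and "\<And>i. i \<in> I \<Longrightarrow> odot_consonant_space (X i)"
    and "\<And>i. i \<in> I \<Longrightarrow> sober_space (X i)"
  shows "odot_consonant_space (projective_limit I le X p) \<and> sober_space (projective_limit I le X p)"
proof -
  interpret proj_system I le X p by (rule proj_system.intro) fact
  show ?thesis
    using odot_consonant_projective_limit sober_projective_limit assms(2-4) by blast
qed

end
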